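(* Let $\mathcal{F}$ be a building set in the Boolean lattice $2^{[n]}$ and let $c_3$ be the number of $3$-circuits in $\mathcal{F}$. Then the coefficient $b_2$ of the Poincaré polynomial of the corresponding arrangement $\mathcal{A}_{\mathcal{F}}$ is $$b_2=\binom{|\mathcal{F}|}{2}-c_3.$$
   Context: A building set in the Boolean lattice $2^{[n]}$ is a family $\mathcal{F}$ of nonempty subsets of $[n]=\{1,\dots,n\}$ containing all singletons and such that $F,F'\in\mathcal{F}$, $F\cap F'\ne\emptyset$ imply $F\cup F'\in\mathcal{F}$. The corresponding arrangement is $\mathcal{A}_{\mathcal{F}}=\{H_I\mid I\in\mathcal{F}\}$ in $V=\mathbb{Q}^n$, where $H_I=\ker\sum_{i\in I}x_i$. A $k$-circuit of $\mathcal{F}$ is a subset $C\subset\mathcal{F}$ with $|C|=k$ for which there is an element $b_C\in C$ such that $b_C=\bigsqcup_{I\in C\setminus\{b_C\}}I$ (disjoint union). For an arrangement $\mathcal{A}$, $L(\mathcal{A})$ is the set of intersections of hyperplanes of $\mathcal{A}$ (including $V$) ordered by reverse inclusion, $\mathrm{rank}(X)=\operatorname{codim}_V X$, $\mu(X)=\mu(V,X)$ is its Möbius function, and the Poincaré polynomial is $\pi(\mathcal{A},t)=\sum_{X\in L(\mathcal{A})}\mu(X)(-t)^{\mathrm{rank}(X)}$; $b_i$ denotes the coefficient of $t^i$ in $\pi(\mathcal{A},t)$. *)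

theory Defs
  imports "HOL-Analysis.Cartesian_Space" "HOL-Computational_Algebra.Polynomial"
    "HOL-Library.Disjoint_Sets"
begin

text \<open>The ground set \<open>[n]\<close> is the universe of a finite index type \<open>'n\<close>, so that
  \<open>n = CARD('n)\<close> and \<open>V = rat ^ 'n\<close>.\<close>

definition building_set :: "'n set set \<Rightarrow> bool" where
  "building_set F \<longleftrightarrow>
     {} \<notin> F \<and> (\<forall>i. {i} \<in> F) \<and> (\<forall>A\<in>F. \<forall>B\<in>F. A \<inter> B \<noteq> {} \<longrightarrow> A \<union> B \<in> F)"

definition circuit :: "'n set set \<Rightarrow> nat \<Rightarrow> 'n set set \<Rightarrow> bool" where
  "circuit F k C \<longleftrightarrow>
     C \<subseteq> F \<and> card C = k \<and> (\<exists>b\<in>C. disjoint (C - {b}) \<and> b = \<Union>(C - {b}))"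

definition sum_hyperplane :: "'n::finite set \<Rightarrow> (rat ^ 'n) set" where
  "sum_hyperplane I = {x. (\<Sum>i\<in>I. x $ i) = 0}"

definition arrangement :: "'n::finite set set \<Rightarrow> (rat ^ 'n) set set" where
  "arrangement F = sum_hyperplane ` F"

text \<open>The empty subfamily contributes \<open>\<Inter>{} = UNIV\<close>, the ambient space.\<close>

definition intersection_lattice :: "'a set set \<Rightarrow> 'a set set" where
  "intersection_lattice \<A> = {\<Inter>B | B. B \<subseteq> \<A>}"

text \<open>The dimension is the one over the field \<open>'k\<close>, not the real dimension.\<close>

definition codim :: "('k::field ^ 'n::finite) set \<Rightarrow> nat" where
  "codim X = vec.dim (UNIV :: ('k ^ 'n) set) - vec.dim X"

text \<open>The Moebius function of a finite family \<open>L\<close> of sets ordered by reverse inclusion,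
  i.e. \<open>\<mu>(X,X) = 1\<close> and \<open>\<mu>(X,Y) = - (\<Sum> X \<le> Z < Y. \<mu>(X,Z))\<close> for \<open>X < Y\<close>, where \<open>X \<le> Y\<close> means
  \<open>Y \<subseteq> X\<close>. It is meant for \<open>X\<close> and \<open>Y\<close> in \<open>L\<close>; finiteness is tested only to make the
  recursion terminate.\<close>

function moebius :: "'a set set \<Rightarrow> 'a set \<Rightarrow> 'a set \<Rightarrow> int" where
  "moebius L X Y =
     (if X = Y then 1
      else if finite L \<and> Y \<subset> X then - (\<Sum>Z\<in>{Z\<in>L. Z \<subseteq> X \<and> Y \<subset> Z}. moebius L X Z)
      else 0)"
  by pat_completeness auto
termination
proof (relation "measure (\<lambda>(L, X, Y). card {Z\<in>L. Y \<subset> Z})", goal_cases)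
  case (2 L X Y Z)
  then have "{W\<in>L. Z \<subset> W} \<subset> {W\<in>L. Y \<subset> W}" by auto
  with 2 show ?case by (auto intro: psubset_card_mono)
qed simp

declare moebius.simps [simp del]

definition poincare_polynomial :: "('k::field ^ 'n::finite) set set \<Rightarrow> int poly" where
  "poincare_polynomial \<A> =
     (\<Sum>X\<in>intersection_lattice \<A>.
        smult (moebius (intersection_lattice \<A>) UNIV X) ((- monom 1 1) ^ codim X))"

end

theory Submission
  imports Defs
begin

text \<open>
  The coefficient \<open>b\<^sub>2\<close> is the sum of \<open>\<mu>(V, X)\<close> over the flats \<open>X\<close> of codimension two. The interval
  below such an \<open>X\<close> consists of \<open>V\<close>, of the \<open>m\<close> hyperplanes through \<open>X\<close>, each with value \<open>-1\<close>,
  and of \<open>X\<close>; hence \<open>\<mu>(V, X) = m - 1\<close> (\<open>moebius_codim_2\<close>).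

  The combinatorial heart is that \<open>m\<close> can only be 2 or 3. Three distinct nonzero 0/1 vectors are
  linearly dependent over the rationals only if one of them is the sum of the other two
  (\<open>dependent_triple_cases\<close>), that is, if the three sets form a 3-circuit. Two members of a
  3-circuit determine the third, so a fourth set through \<open>X\<close> is impossible
  (\<open>sets_through_dichotomy\<close>). So \<open>m - 1\<close> is the number of pairs among the \<open>m\<close> sets minus the number
  of 3-circuits among them: \<open>1 = 1 - 0\<close> or \<open>2 = 3 - 1\<close> (\<open>card_sets_through_minus_1\<close>).

  Every pair of members of the family, and every 3-circuit, has its hyperplanes meet in exactly
  one flat of codimension two (\<open>card_flats_through_generating_pair\<close>). Summing over all these flats
  therefore counts every pair and every 3-circuit once, and the formula follows.
\<close>

section \<open>Hyperplanes and codimension\<close>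

lemma sum_axis_component:
  "(\<Sum>i\<in>I. axis a c $ i) = (if a \<in> I then c else (0::rat))" for I :: "'n::finite set"
  by (simp add: axis_def)

lemmas mem_sum_hyperplane = sum_hyperplane_def sum_axis_component sum.distrib sum_subtractf

lemma subspace_sum_hyperplane: "vec.subspace (sum_hyperplane I)"
  by (rule vec.subspaceI)
    (auto simp: sum_hyperplane_def sum.distrib simp flip: sum_distrib_left)

text \<open>Any vector of \<open>S\<close> off the hyperplane spans a complement of the intersection in \<open>S\<close>: subtract
  from \<open>x\<close> the multiple of \<open>v\<close> on which the coordinate sum over \<open>I\<close> agrees with that of \<open>x\<close>.\<close>

lemma dim_Int_sum_hyperplane:
  assumes S: "vec.subspace S" and v: "v \<in> S" "v \<notin> sum_hyperplane I"
  shows "vec.dim S = Suc (vec.dim (S \<inter> sum_hyperplane I))"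
proof -
  let ?T = "S \<inter> sum_hyperplane I"
  have T: "vec.subspace ?T"
    using S subspace_sum_hyperplane by (rule vec.subspace_inter)
  have "S \<subseteq> vec.span (insert v ?T)"
  proof
    fix x assume x: "x \<in> S"
    define c where "c = (\<Sum>i\<in>I. x $ i) / (\<Sum>i\<in>I. v $ i)"
    have "x - c *s v \<in> S"
      using x v S by (intro vec.subspace_diff vec.subspace_scale)
    moreover have "(\<Sum>i\<in>I. (x - c *s v) $ i) = (\<Sum>i\<in>I. x $ i) - c * (\<Sum>i\<in>I. v $ i)"
      by (simp add: sum_subtractf flip: sum_distrib_left)
    then have "x - c *s v \<in> sum_hyperplane I"
      using v by (simp add: sum_hyperplane_def c_def)
    ultimately have "x - c *s v \<in> vec.span ?T"
      by (simp add: vec.span_base)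
    then show "x \<in> vec.span (insert v ?T)"
      by (auto simp: vec.span_insert)
  qed
  moreover have "vec.span (insert v ?T) \<subseteq> S"
    using S v by (intro vec.span_minimal) auto
  ultimately have "vec.dim S = vec.dim (insert v ?T)"
    by (metis vec.dim_span subset_antisym)
  also have "\<dots> = Suc (vec.dim ?T)"
    using v T by (simp add: vec.dim_insert vec.span_eq_iff[THEN iffD2])
  finally show ?thesis .
qed

lemma codim_mono: "X \<subseteq> Y \<Longrightarrow> codim Y \<le> codim X"
  unfolding codim_def by (intro diff_le_mono2 vec.dim_subset)

lemma subspace_eqI_codim:
  fixes X Y :: "('k::field ^ 'n::finite) set"
  assumes "vec.subspace X" "vec.subspace Y" "X \<subseteq> Y" "codim X \<le> codim Y"
  shows "X = Y"
proof (rule vec.subspace_dim_equal)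
  have "vec.dim X \<le> vec.dim (UNIV :: ('k ^ 'n) set)"
    by (rule vec.dim_subset) simp
  moreover have "vec.dim Y \<le> vec.dim (UNIV :: ('k ^ 'n) set)"
    by (rule vec.dim_subset) simp
  ultimately show "vec.dim X \<ge> vec.dim Y"
    using assms(4) unfolding codim_def by linarith
qed (use assms in auto)

lemma codim_UNIV [simp]: "codim UNIV = 0"
  by (simp add: codim_def)

lemma codim_sum_hyperplane:
  assumes "I \<noteq> {}"
  shows "codim (sum_hyperplane I) = 1"
proof -
  from assms obtain i where "i \<in> I" by blast
  then have "axis i 1 \<notin> sum_hyperplane I"
    by (simp add: mem_sum_hyperplane)
  from dim_Int_sum_hyperplane[OF vec.subspace_UNIV UNIV_I this] show ?thesis
    unfolding codim_def by simp
qed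

text \<open>A hyperplane \<open>H\<^sub>I\<close> determines \<open>I\<close>, because the unit vectors it misses are those indexed
  by \<open>I\<close>. So counting hyperplanes through a flat is the same as counting sets.\<close>

lemma sum_hyperplane_subset_imp_eq:
  assumes "I \<noteq> {}" "J \<noteq> {}" "sum_hyperplane I \<subseteq> sum_hyperplane J"
  shows "I = J"
proof -
  have eq: "sum_hyperplane I = sum_hyperplane J"
    using assms by (intro subspace_eqI_codim)
      (auto simp: codim_sum_hyperplane subspace_sum_hyperplane)
  have "i \<in> I \<longleftrightarrow> i \<in> J" for i
    using arg_cong[OF eq, of "\<lambda>X. axis i 1 \<in> X"] by (simp add: mem_sum_hyperplane split: if_splits)
  then show ?thesis by blast
qed

lemma codim_Int_sum_hyperplane:
  assumes "I \<noteq> {}" "J \<noteq> {}" "I \<noteq> J"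
  shows "codim (sum_hyperplane I \<inter> sum_hyperplane J) = 2"
proof -
  from assms sum_hyperplane_subset_imp_eq obtain v where "v \<in> sum_hyperplane I" "v \<notin> sum_hyperplane J"
    by blast
  from dim_Int_sum_hyperplane[OF subspace_sum_hyperplane this] codim_sum_hyperplane[OF assms(1)]
  show ?thesis
    unfolding codim_def by linarith
qed

section \<open>Three hyperplanes through a common flat of codimension two\<close>

text \<open>This is the form in which the next lemma pins down \<open>K\<close> when one cell of the Venn diagram of
  \<open>I\<close> and \<open>J\<close> is empty.\<close>

lemma union_of_two_blocks:
  assumes "P \<subseteq> K \<or> P \<inter> K = {}" "Q \<subseteq> K \<or> Q \<inter> K = {}" "K \<subseteq> P \<union> Q"
  shows "K = {} \<or> K = P \<or> K = Q \<or> K = P \<union> Q"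
  using assms by blast

text \<open>Testing the inclusion on vectors of \<open>H\<^sub>I \<inter> H\<^sub>J\<close> with at most three nonzero coordinates
  determines \<open>K\<close>. Unit vectors outside \<open>I \<union> J\<close> give \<open>K \<subseteq> I \<union> J\<close>, and differences of two
  unit vectors show that \<open>K\<close> is a union of cells among \<open>I - J\<close>, \<open>J - I\<close> and \<open>I \<inter> J\<close>. If all three
  cells are inhabited, then \<open>e\<^sub>i + e\<^sub>j - e\<^sub>k\<close> with one index from each lies in both hyperplanes and
  forces \<open>K\<close> to be \<open>I\<close>, \<open>J\<close> or empty. So some cell is empty, and \<open>K\<close> is built from the other two.\<close>

lemma dependent_triple_cases:
  assumes ne: "I \<noteq> {}" "J \<noteq> {}" "K \<noteq> {}" and dist: "I \<noteq> J" "I \<noteq> K" "J \<noteq> K"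
    and sub: "sum_hyperplane I \<inter> sum_hyperplane J \<subseteq> sum_hyperplane K"
  shows "I \<inter> J = {} \<and> K = I \<union> J \<or> J \<inter> K = {} \<and> I = J \<union> K \<or> I \<inter> K = {} \<and> J = I \<union> K"
proof -
  have outside: "i \<notin> K" if "i \<notin> I" "i \<notin> J" for i
    using subsetD[OF sub, of "axis i 1"] that by (simp add: mem_sum_hyperplane split: if_splits)
  have atom: "i \<in> K \<longleftrightarrow> j \<in> K" if "i \<in> I \<longleftrightarrow> j \<in> I" "i \<in> J \<longleftrightarrow> j \<in> J" for i j
    using subsetD[OF sub, of "axis i 1 - axis j 1"] that
    by (simp add: mem_sum_hyperplane split: if_splits)
  have balance: "(if i \<in> K then 1 else 0) + (if j \<in> K then 1 else 0) = (if k \<in> K then 1 else (0::rat))"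
    if "i \<in> I - J" "j \<in> J - I" "k \<in> I \<inter> J" for i j k
    using subsetD[OF sub, of "axis i 1 + axis j 1 - axis k 1"] that
    by (simp add: mem_sum_hyperplane)
  consider "I \<inter> J = {}" | "I \<subseteq> J" | "J \<subseteq> I"
    | i j k where "i \<in> I - J" "j \<in> J - I" "k \<in> I \<inter> J"
    by blast
  then show ?thesis
  proof cases
    case 1
    have "I \<subseteq> K \<or> I \<inter> K = {}" "J \<subseteq> K \<or> J \<inter> K = {}" "K \<subseteq> I \<union> J"
      using atom outside 1 by blast+
    then have "K = {} \<or> K = I \<or> K = J \<or> K = I \<union> J" by (rule union_of_two_blocks)
    then show ?thesis using 1 ne dist by auto
  next
    case 2
    have "I \<subseteq> K \<or> I \<inter> K = {}" "J - I \<subseteq> K \<or> (J - I) \<inter> K = {}" "K \<subseteq> I \<union> (J - I)"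
      using atom outside 2 by blast+
    then have "K = {} \<or> K = I \<or> K = J - I \<or> K = I \<union> (J - I)" by (rule union_of_two_blocks)
    moreover have "I \<union> (J - I) = J" using 2 by blast
    ultimately have "K = J - I" using ne dist by metis
    then show ?thesis using 2 by blast
  next
    case 3
    have "J \<subseteq> K \<or> J \<inter> K = {}" "I - J \<subseteq> K \<or> (I - J) \<inter> K = {}" "K \<subseteq> J \<union> (I - J)"
      using atom outside 3 by blast+
    then have "K = {} \<or> K = J \<or> K = I - J \<or> K = J \<union> (I - J)" by (rule union_of_two_blocks)
    moreover have "J \<union> (I - J) = I" using 3 by blast
    ultimately have "K = I - J" using ne dist by metis
    then show ?thesis using 3 by blast
  next
    case 4
    consider "i \<in> K" "j \<notin> K" "k \<in> K" | "i \<notin> K" "j \<in> K" "k \<in> K" | "i \<notin> K" "j \<notin> K" "k \<notin> K"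
      using balance[OF 4] by (auto split: if_splits)
    then have "K = I \<or> K = J \<or> K = {}"
    proof cases
      case 1
      then have "x \<in> K \<longleftrightarrow> x \<in> I" for x
        using atom[of x i] atom[of x j] atom[of x k] outside[of x] 4 by blast
      then show ?thesis by blast
    next
      case 2
      then have "x \<in> K \<longleftrightarrow> x \<in> J" for x
        using atom[of x i] atom[of x j] atom[of x k] outside[of x] 4 by blast
      then show ?thesis by blast
    next
      case 3
      then have "x \<notin> K" for x
        using atom[of x i] atom[of x j] atom[of x k] outside[of x] 4 by blast
      then show ?thesis by blast
    qed
    then show ?thesis using ne dist by blast
  qed
qed

text \<open>Writing a 3-circuit as \<open>{A, B, A \<union> B}\<close> is legitimate because disjoint nonempty sets \<open>A\<close> and \<open>B\<close>
  automatically make the three members distinct.\<close>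

lemma circuit_3_iff:
  assumes "{} \<notin> F"
  shows "circuit F 3 C \<longleftrightarrow>
    (\<exists>A B. A \<in> F \<and> B \<in> F \<and> A \<union> B \<in> F \<and> A \<inter> B = {} \<and> C = {A, B, A \<union> B})"
proof
  assume "circuit F 3 C"
  then obtain b where C: "C \<subseteq> F" "card C = 3" and b: "b \<in> C" "disjoint (C - {b})" "b = \<Union>(C - {b})"
    by (auto simp: circuit_def)
  have "card (C - {b}) = 2" using C b by simp
  then obtain A B where AB: "C - {b} = {A, B}" "A \<noteq> B" by (auto simp: card_2_iff)
  have "b = A \<union> B" using b(3) AB(1) by simp
  moreover have "A \<inter> B = {}" using b(2) AB by (auto simp: disjoint_def)
  moreover have "C = {A, B, b}" using AB(1) b(1) by blast
  ultimately show "\<exists>A B. A \<in> F \<and> B \<in> F \<and> A \<union> B \<in> F \<and> A \<inter> B = {} \<and> C = {A, B, A \<union> B}"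
    using C(1) by blast
next
  assume "\<exists>A B. A \<in> F \<and> B \<in> F \<and> A \<union> B \<in> F \<and> A \<inter> B = {} \<and> C = {A, B, A \<union> B}"
  then obtain A B where AB: "A \<in> F" "B \<in> F" "A \<union> B \<in> F" "A \<inter> B = {}" and C: "C = {A, B, A \<union> B}"
    by blast
  have ne: "A \<noteq> B" "A \<noteq> A \<union> B" "B \<noteq> A \<union> B" using AB assms by (metis Un_upper1 Un_upper2 inf.absorb1 inf.absorb2 inf.idem)+
  have "C - {A \<union> B} = {A, B}" using C ne by blast
  then show "circuit F 3 C"
    unfolding circuit_def using AB C ne
    by (intro conjI bexI[of _ "A \<union> B"]) (auto simp: disjoint_def)
qed

definition sets_through :: "'n::finite set set \<Rightarrow> (rat ^ 'n) set \<Rightarrow> 'n set set" where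
  "sets_through F X = {K \<in> F. X \<subseteq> sum_hyperplane K}"

lemma circuit_3_of_sets_through:
  assumes F: "{} \<notin> F" and "I \<in> F" "J \<in> F" "K \<in> F" "I \<noteq> J" "I \<noteq> K" "J \<noteq> K"
    and "sum_hyperplane I \<inter> sum_hyperplane J \<subseteq> sum_hyperplane K"
  shows "circuit F 3 {I, J, K}"
proof -
  have "I \<inter> J = {} \<and> K = I \<union> J \<or> J \<inter> K = {} \<and> I = J \<union> K \<or> I \<inter> K = {} \<and> J = I \<union> K"
    using assms by (intro dependent_triple_cases) auto
  then show ?thesis
  proof (elim disjE conjE)
    assume "I \<inter> J = {}" "K = I \<union> J"
    then show ?thesis unfolding circuit_3_iff[OF F] using assms
      by (intro exI[of _ I] exI[of _ J]) auto
  next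
    assume "J \<inter> K = {}" "I = J \<union> K"
    then show ?thesis unfolding circuit_3_iff[OF F] using assms
      by (intro exI[of _ J] exI[of _ K]) auto
  next
    assume "I \<inter> K = {}" "J = I \<union> K"
    then show ?thesis unfolding circuit_3_iff[OF F] using assms
      by (intro exI[of _ I] exI[of _ K]) auto
  qed
qed

text \<open>A third set \<open>K\<close> through the flat makes \<open>{I, J, K}\<close> a circuit, and a fourth set \<open>D\<close> would make
  \<open>{I, J, D}\<close> one as well. The relative position of \<open>I\<close> and \<open>J\<close> (disjoint, or one containing the
  other) decides which of the three is the union, hence determines the third member of the
  circuit: it is \<open>I \<union> J\<close> or the difference of the two. So \<open>D = K\<close>.\<close>

lemma sets_through_dichotomy:
  assumes F: "{} \<notin> F" and IJ: "I \<in> F" "J \<in> F" "I \<noteq> J"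
    and X: "X = sum_hyperplane I \<inter> sum_hyperplane J"
  shows "sets_through F X = {I, J} \<or> circuit F 3 (sets_through F X)"
proof (cases "sets_through F X = {I, J}")
  case False
  have "{I, J} \<subseteq> sets_through F X" using IJ X by (auto simp: sets_through_def)
  with False obtain K where "K \<in> sets_through F X" "K \<noteq> I" "K \<noteq> J" by blast
  then have K: "K \<in> F" "sum_hyperplane I \<inter> sum_hyperplane J \<subseteq> sum_hyperplane K" "K \<noteq> I" "K \<noteq> J"
    using X by (auto simp: sets_through_def)
  have circ: "circuit F 3 {I, J, K}"
    using assms K by (intro circuit_3_of_sets_through) auto
  moreover have "sets_through F X = {I, J, K}"
  proof (rule ccontr)
    assume "sets_through F X \<noteq> {I, J, K}"
    then obtain D where D: "D \<in> sets_through F X" "D \<noteq> I" "D \<noteq> J" "D \<noteq> K"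
      using IJ K X by (auto simp: sets_through_def)
    then have DF: "D \<in> F" "sum_hyperplane I \<inter> sum_hyperplane J \<subseteq> sum_hyperplane D"
      using X by (auto simp: sets_through_def)
    have ne: "I \<noteq> {}" "J \<noteq> {}" "K \<noteq> {}" "D \<noteq> {}" using F IJ K DF by auto
    have "I \<inter> J = {} \<and> K = I \<union> J \<or> J \<inter> K = {} \<and> I = J \<union> K \<or> I \<inter> K = {} \<and> J = I \<union> K"
      using ne IJ K by (intro dependent_triple_cases) auto
    moreover have "I \<inter> J = {} \<and> D = I \<union> J \<or> J \<inter> D = {} \<and> I = J \<union> D \<or> I \<inter> D = {} \<and> J = I \<union> D"
      using ne IJ DF D by (intro dependent_triple_cases) auto
    ultimately show False using ne D IJ(3) by blast
  qed
  ultimately show ?thesis by simp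
qed simp

section \<open>The flats of codimension at most two and their Moebius values\<close>

lemma Inter_in_lattice_cases:
  assumes "Z \<in> intersection_lattice (arrangement F)"
  obtains "Z = UNIV" | I where "I \<in> F" "Z \<subseteq> sum_hyperplane I"
  using assms unfolding intersection_lattice_def arrangement_def by blast

lemma subspace_lattice:
  "Z \<in> intersection_lattice (arrangement F) \<Longrightarrow> vec.subspace Z"
  unfolding intersection_lattice_def arrangement_def
  using subspace_sum_hyperplane by (auto intro!: vec.subspace_Inter)

lemma UNIV_in_lattice: "UNIV \<in> intersection_lattice (arrangement F)"
  unfolding intersection_lattice_def by auto

lemma sum_hyperplane_in_lattice:
  "I \<in> F \<Longrightarrow> sum_hyperplane I \<in> intersection_lattice (arrangement F)"
  unfolding intersection_lattice_def arrangement_def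
  by (auto intro!: exI[of _ "{sum_hyperplane I}"])

lemma Int_in_lattice:
  "I \<in> F \<Longrightarrow> J \<in> F \<Longrightarrow> sum_hyperplane I \<inter> sum_hyperplane J \<in> intersection_lattice (arrangement F)"
  unfolding intersection_lattice_def arrangement_def
  by (auto intro!: exI[of _ "{sum_hyperplane I, sum_hyperplane J}"])

lemma finite_lattice: "finite (intersection_lattice (arrangement F))"
proof -
  have "intersection_lattice (arrangement F) = Inter ` Pow (arrangement F)"
    unfolding intersection_lattice_def by auto
  then show ?thesis by (simp add: arrangement_def)
qed

lemma lattice_codim_le_1:
  assumes F: "{} \<notin> F" and Z: "Z \<in> intersection_lattice (arrangement F)" "codim Z \<le> 1"
  shows "Z = UNIV \<or> (\<exists>I\<in>F. Z = sum_hyperplane I)"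
  using Z(1)
proof (cases rule: Inter_in_lattice_cases)
  case (2 I)
  then have "codim (sum_hyperplane I) = 1"
    using F by (intro codim_sum_hyperplane) auto
  then have "Z = sum_hyperplane I"
    using 2 Z subspace_lattice[OF Z(1)] subspace_sum_hyperplane
    by (intro subspace_eqI_codim) auto
  with 2 show ?thesis by blast
qed simp

text \<open>Any two distinct hyperplanes through \<open>X\<close> already cut out \<open>X\<close>, by comparison of dimensions; an
  intersection of fewer than two hyperplanes has codimension at most one.\<close>

lemma lattice_codim_2:
  assumes F: "{} \<notin> F" and X: "X \<in> intersection_lattice (arrangement F)" "codim X = 2"
  obtains I J where "I \<in> F" "J \<in> F" "I \<noteq> J" "X = sum_hyperplane I \<inter> sum_hyperplane J"
proof -
  from X(1) obtain G where G: "G \<subseteq> F" "X = (\<Inter>K\<in>G. sum_hyperplane K)"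
    unfolding intersection_lattice_def arrangement_def by (auto simp: subset_image_iff)
  have "G \<noteq> {}" using G X by auto
  then obtain I where I: "I \<in> G" by blast
  have "I \<noteq> {}" using F G I by auto
  then have "G \<noteq> {I}" using G X codim_sum_hyperplane[of I] by auto
  with I obtain J where J: "J \<in> G" "I \<noteq> J" by blast
  have IJ: "I \<in> F" "J \<in> F" using I J G by auto
  then have "codim (sum_hyperplane I \<inter> sum_hyperplane J) = 2"
    using F J by (intro codim_Int_sum_hyperplane) auto
  then have "X = sum_hyperplane I \<inter> sum_hyperplane J"
    using X G I J subspace_lattice[OF X(1)] subspace_lattice[OF Int_in_lattice[OF IJ]]
    by (intro subspace_eqI_codim) auto
  with IJ J that show ?thesis by blast
qed

lemma moebius_sum_hyperplane:
  assumes F: "{} \<notin> F" and I: "I \<in> F"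
  shows "moebius (intersection_lattice (arrangement F)) UNIV (sum_hyperplane I) = -1"
proof -
  let ?L = "intersection_lattice (arrangement F)"
  have codim: "codim (sum_hyperplane I) = 1"
    using F I by (intro codim_sum_hyperplane) auto
  then have ne: "sum_hyperplane I \<noteq> UNIV" by auto
  have "Z = UNIV" if Z: "Z \<in> ?L" "sum_hyperplane I \<subset> Z" for Z
  proof -
    have "codim Z \<le> 1" using codim codim_mono[of "sum_hyperplane I" Z] Z by auto
    with lattice_codim_le_1[OF F Z(1)] consider "Z = UNIV" | J where "J \<in> F" "Z = sum_hyperplane J"
      by blast
    then show ?thesis
    proof cases
      case 2
      then have "I = J"
        using F I Z by (intro sum_hyperplane_subset_imp_eq) auto
      with 2 Z show ?thesis by simp
    qed
  qed
  then have "{Z \<in> ?L. Z \<subseteq> UNIV \<and> sum_hyperplane I \<subset> Z} = {UNIV}"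
    using ne UNIV_in_lattice by auto
  then show ?thesis
    using ne finite_lattice[of F]
    by (subst moebius.simps) (auto simp: moebius.simps[of _ UNIV UNIV])
qed

text \<open>Strictly between \<open>V\<close> and a flat of codimension two lie only flats of codimension one, which are
  the hyperplanes of the arrangement through it.\<close>

lemma moebius_codim_2:
  assumes F: "{} \<notin> F" and X: "X \<in> intersection_lattice (arrangement F)" "codim X = 2"
  shows "moebius (intersection_lattice (arrangement F)) UNIV X = int (card (sets_through F X)) - 1"
proof -
  let ?L = "intersection_lattice (arrangement F)"
  have ne: "X \<noteq> UNIV" using X by auto
  have codim: "codim (sum_hyperplane I) = 1" if "I \<in> F" for I
    using F that by (intro codim_sum_hyperplane) auto
  have above: "{Z \<in> ?L. Z \<subseteq> UNIV \<and> X \<subset> Z} = insert UNIV (sum_hyperplane ` sets_through F X)"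
  proof (intro equalityI subsetI)
    fix Z assume "Z \<in> {Z \<in> ?L. Z \<subseteq> UNIV \<and> X \<subset> Z}"
    then have Z: "Z \<in> ?L" "X \<subset> Z" by auto
    have "codim Z \<le> 1"
      using subspace_eqI_codim[OF subspace_lattice[OF X(1)] subspace_lattice[OF Z(1)]] X(2) Z(2)
      by fastforce
    with lattice_codim_le_1[OF F Z(1)] Z
    show "Z \<in> insert UNIV (sum_hyperplane ` sets_through F X)"
      by (auto simp: sets_through_def)
  next
    fix Z assume "Z \<in> insert UNIV (sum_hyperplane ` sets_through F X)"
    then show "Z \<in> {Z \<in> ?L. Z \<subseteq> UNIV \<and> X \<subset> Z}"
      using ne UNIV_in_lattice sum_hyperplane_in_lattice codim X(2)
      by (auto simp: sets_through_def psubset_eq)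
  qed
  have "UNIV \<notin> sum_hyperplane ` sets_through F X"
    using codim by (force simp: sets_through_def)
  moreover have "inj_on sum_hyperplane (sets_through F X)"
  proof (rule inj_onI)
    fix I J assume "I \<in> sets_through F X" "J \<in> sets_through F X" "sum_hyperplane I = sum_hyperplane J"
    then show "I = J"
      using F by (intro sum_hyperplane_subset_imp_eq) (auto simp: sets_through_def)
  qed
  ultimately have "(\<Sum>Z\<in>{Z \<in> ?L. Z \<subseteq> UNIV \<and> X \<subset> Z}. moebius ?L UNIV Z) =
      1 + (\<Sum>I\<in>sets_through F X. moebius ?L UNIV (sum_hyperplane I))"
    unfolding above by (simp add: sum.reindex moebius.simps[of _ UNIV UNIV])
  also have "(\<Sum>I\<in>sets_through F X. moebius ?L UNIV (sum_hyperplane I)) =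
      (\<Sum>I\<in>sets_through F X. -1)"
    by (intro sum.cong) (auto simp: moebius_sum_hyperplane[OF F] sets_through_def)
  finally have "(\<Sum>Z\<in>{Z \<in> ?L. Z \<subseteq> UNIV \<and> X \<subset> Z}. moebius ?L UNIV Z) =
      1 - int (card (sets_through F X))"
    by simp
  moreover have "X \<subset> UNIV" using ne by blast
  ultimately show ?thesis
    by (subst moebius.simps) (use ne finite_lattice[of F] in simp)
qed

section \<open>Counting pairs and circuits flat by flat\<close>

lemma coeff_2_poincare_polynomial:
  "coeff (poincare_polynomial (arrangement F)) 2 =
    (\<Sum>X\<in>{X \<in> intersection_lattice (arrangement F). codim X = 2}.
        moebius (intersection_lattice (arrangement F)) UNIV X)"
proof -
  have coeff: "coeff ((- monom 1 1) ^ k) 2 = (if k = 2 then 1 else (0::int))" for k :: nat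
    by (simp add: minus_monom monom_power)
  show ?thesis
    unfolding poincare_polynomial_def coeff_sum coeff_smult coeff
    by (simp add: sum.inter_filter[OF finite_lattice] if_distrib cong: if_cong)
qed

text \<open>This identity turns Moebius values into counts that are additive over the flats. By the
  dichotomy it only has to hold for two sets, where it reads \<open>1 = 1 - 0\<close>, and for three sets
  forming a circuit, where it reads \<open>2 = 3 - 1\<close>.\<close>

lemma card_sets_through_minus_1:
  assumes F: "{} \<notin> F" and X: "X \<in> intersection_lattice (arrangement F)" "codim X = 2"
  shows "int (card (sets_through F X)) - 1 =
    int (card {P. P \<subseteq> F \<and> card P = 2 \<and> P \<subseteq> sets_through F X}) -
    int (card {C. circuit F 3 C \<and> C \<subseteq> sets_through F X})"
proof -
  obtain I J where IJ: "I \<in> F" "J \<in> F" "I \<noteq> J" "X = sum_hyperplane I \<inter> sum_hyperplane J"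
    using lattice_codim_2[OF F X] by blast
  let ?S = "sets_through F X"
  have "?S \<subseteq> F" by (auto simp: sets_through_def)
  then have "{P. P \<subseteq> F \<and> card P = 2 \<and> P \<subseteq> ?S} = {P. P \<subseteq> ?S \<and> card P = 2}" by blast
  then have pairs: "card {P. P \<subseteq> F \<and> card P = 2 \<and> P \<subseteq> ?S} = card ?S choose 2"
    by (simp add: n_subsets)
  have circuits: "C = ?S" if "circuit F 3 C" "C \<subseteq> ?S" "card ?S \<le> 3" for C
    using that by (intro card_seteq) (auto simp: circuit_def)
  from sets_through_dichotomy[OF F IJ] show ?thesis
  proof
    assume S: "?S = {I, J}"
    then have c: "card ?S = 2" using IJ by simp
    have "\<not> circuit F 3 ?S" using c by (simp add: circuit_def)
    then have "{C. circuit F 3 C \<and> C \<subseteq> ?S} = {}" using circuits c by auto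
    with pairs c show ?thesis by simp
  next
    assume S: "circuit F 3 ?S"
    then have c: "card ?S = 3" by (simp add: circuit_def)
    have "{C. circuit F 3 C \<and> C \<subseteq> ?S} = {?S}" using circuits S c by auto
    with pairs c show ?thesis by (simp add: choose_two)
  qed
qed

text \<open>The premise \<open>gen\<close> is met by both subfamilies to be counted: a pair \<open>C = {I, J}\<close>, and a circuit
  \<open>C = {I, J, I \<union> J}\<close>. The only flat in question is \<open>H\<^sub>I \<inter> H\<^sub>J\<close>, since a flat contained in it has
  codimension two only if it is equal to it.\<close>

lemma card_flats_through_generating_pair:
  assumes F: "{} \<notin> F" and IJ: "I \<in> F" "J \<in> F" "I \<noteq> J" "{I, J} \<subseteq> C" "C \<subseteq> F"
    and gen: "\<And>K. K \<in> C \<Longrightarrow> sum_hyperplane I \<inter> sum_hyperplane J \<subseteq> sum_hyperplane K"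
  shows "card {X \<in> {X \<in> intersection_lattice (arrangement F). codim X = 2}.
           C \<subseteq> sets_through F X} = 1"
proof -
  let ?Y = "sum_hyperplane I \<inter> sum_hyperplane J"
  have Y: "?Y \<in> intersection_lattice (arrangement F)" "codim ?Y = 2"
    using F IJ by (auto intro!: Int_in_lattice codim_Int_sum_hyperplane)
  have "X = ?Y" if X: "X \<in> intersection_lattice (arrangement F)" "codim X = 2"
    "C \<subseteq> sets_through F X" for X
    using X Y IJ subspace_lattice[OF X(1)] subspace_lattice[OF Y(1)]
    by (intro subspace_eqI_codim) (auto simp: sets_through_def)
  moreover have "C \<subseteq> sets_through F ?Y"
    using IJ gen by (auto simp: sets_through_def)
  ultimately have "{X \<in> {X \<in> intersection_lattice (arrangement F). codim X = 2}.
      C \<subseteq> sets_through F X} = {?Y}"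
    using Y by blast
  then show ?thesis by simp
qed

theorem corollary3p17:
  fixes F :: "'n::finite set set"
  assumes "building_set F"
  shows "coeff (poincare_polynomial (arrangement F)) 2 =
           int (card F choose 2) - int (card {C. circuit F 3 C})"
proof -
  have F: "{} \<notin> F" using assms by (simp add: building_set_def)
  define R where "R = {X \<in> intersection_lattice (arrangement F). codim X = 2}"
  have fin: "finite R" unfolding R_def using finite_lattice[of F] by simp
  define pairs where "pairs = {P. P \<subseteq> F \<and> card P = 2}"
  define circuits where "circuits = {C. circuit F 3 C}"
  have pair: "card {X \<in> R. P \<subseteq> sets_through F X} = 1" if "P \<in> pairs" for P
  proof -
    from that obtain I J where "P = {I, J}" "I \<noteq> J" "P \<subseteq> F"
      by (auto simp: pairs_def card_2_iff)
    then show ?thesis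
      unfolding R_def by (intro card_flats_through_generating_pair[OF F, of I J]) auto
  qed
  have circ: "card {X \<in> R. C \<subseteq> sets_through F X} = 1" if "C \<in> circuits" for C
  proof -
    from that obtain A B where AB: "A \<in> F" "B \<in> F" "A \<union> B \<in> F" "A \<inter> B = {}" "C = {A, B, A \<union> B}"
      by (auto simp: circuits_def circuit_3_iff[OF F])
    have "sum_hyperplane A \<inter> sum_hyperplane B \<subseteq> sum_hyperplane (A \<union> B)"
      using AB by (auto simp: sum_hyperplane_def sum.union_disjoint)
    moreover have "A \<noteq> B" using AB F by auto
    ultimately show ?thesis
      unfolding R_def using AB by (intro card_flats_through_generating_pair[OF F, of A B]) auto
  qed
  have "coeff (poincare_polynomial (arrangement F)) 2 = (\<Sum>X\<in>R. int (card (sets_through F X)) - 1)"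
    unfolding coeff_2_poincare_polynomial R_def by (intro sum.cong) (auto simp: moebius_codim_2[OF F])
  also have "\<dots> = (\<Sum>X\<in>R. int (card {P \<in> pairs. P \<subseteq> sets_through F X}) -
                          int (card {C \<in> circuits. C \<subseteq> sets_through F X}))"
    unfolding R_def pairs_def circuits_def
    by (intro sum.cong) (auto simp: card_sets_through_minus_1[OF F] conj_assoc)
  also have "\<dots> = int (\<Sum>X\<in>R. card {P \<in> pairs. P \<subseteq> sets_through F X}) -
                  int (\<Sum>X\<in>R. card {C \<in> circuits. C \<subseteq> sets_through F X})"
    by (simp add: sum_subtractf)
  \<comment> \<open>Double counting: every pair, and every circuit, is seen from exactly one flat.\<close>
  also have "(\<Sum>X\<in>R. card {P \<in> pairs. P \<subseteq> sets_through F X}) = 1 * card pairs"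
    using fin pair by (intro sum_multicount) auto
  also have "(\<Sum>X\<in>R. card {C \<in> circuits. C \<subseteq> sets_through F X}) = 1 * card circuits"
    using fin circ by (intro sum_multicount) auto
  also have "card pairs = card F choose 2"
    unfolding pairs_def by (simp add: n_subsets)
  finally show ?thesis by (simp add: circuits_def)
qed

end
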